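(* Let $d\ge 1$ and $m>n\ge 1$ be integers. Let $\overline{f}(d,n,m)$ be the minimum number of sets in an antipodal $\overline{(n,m)}$-fold cover of $S^d$ with open sets. Then $\overline{f}(d,n,m)=d+2m-1$.
   Context: $S^d$ denotes the $d$-dimensional unit sphere in $\mathbb{R}^{d+1}$ centered at the origin. A cover of $S^d$ is a (finite) family of subsets of $S^d$ whose union is $S^d$; it is an $n$-fold cover if every point of $S^d$ belongs to at least $n$ of the sets. A cover is antipodal if none of its sets contains a pair of antipodal points $x,-x$. The closed northern hemisphere is $\{x\in S^d : x_{d+1}\ge 0\}$. For $m>n\ge1$, an $\overline{(n,m)}$-fold cover of $S^d$ is an $n$-fold cover of $S^d$ in which every point of the closed northern hemisphere belongs to at least $m$ of the sets. *)

theory Defs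
  imports "HOL-Analysis.Analysis"
begin

text \<open>The unit sphere S^d is sphere 0 1 in a Euclidean space of dimension d+1.
  A finite family of k sets is an indexed family U 0, ..., U (k-1) (repetitions allowed,
  multiplicities counted). The northern hemisphere is taken w.r.t. a basis vector b
  (playing the role of the last coordinate axis).\<close>

definition antipodal_bar_open_cover ::
  "'a::euclidean_space \<Rightarrow> nat \<Rightarrow> nat \<Rightarrow> nat \<Rightarrow> (nat \<Rightarrow> 'a set) \<Rightarrow> bool" where
  "antipodal_bar_open_cover b n m k U \<longleftrightarrow>
     (\<forall>i<k. openin (top_of_set (sphere 0 1)) (U i)) \<and>
     (\<forall>i<k. \<forall>x\<in>U i. - x \<notin> U i) \<and>
     (\<forall>x\<in>sphere 0 1. n \<le> card {i. i < k \<and> x \<in> U i}) \<and>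
     (\<forall>x\<in>sphere 0 1. 0 \<le> x \<bullet> b \<longrightarrow> m \<le> card {i. i < k \<and> x \<in> U i})"

end

theory Submission
  imports Defs "HOL-Homology.Homology"
begin

text \<open>
  Upper bound: take \<open>d + 2m\<close> points on the moment curve in dimension \<open>d + 1\<close> with alternating
  signs. A nonzero polynomial of degree at most \<open>d\<close> has few roots, so every open hemisphere contains
  at least \<open>m\<close> of these points (Gale), that is, the open hemispheres centred at them form an
  \<open>m\<close>-fold antipodal cover. The curve starts at \<open>- b\<close>; discarding the hemisphere centred there costs
  no multiplicity on the closed northern hemisphere and at most one elsewhere.

  Lower bound: on the equator, a sphere of dimension \<open>d - 1\<close>, the cover is \<open>m\<close>-fold. Keep the first
  \<open>k - 2m + 1\<close> sets and replace the remaining \<open>2m - 1\<close> by the single set of points lying in at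
  least \<open>m\<close> of them; the latter is antipodal because two \<open>m\<close>-subsets of a \<open>(2m - 1)\<close>-set meet.
  Lusternik--Schnirelmann for these \<open>k - 2m + 2\<close> sets gives \<open>k - 2m + 2 \<ge> d + 1\<close>.

  Lusternik--Schnirelmann is proved by Ky Fan's parity count. The vanishing of the homology of the
  sphere below its dimension yields singular chains \<open>c\<^sub>j\<close> with \<open>\<partial> c\<^sub>j\<^sub>+\<^sub>1 = c\<^sub>j \<plusminus> a c\<^sub>j\<close>, where \<open>a\<close> is the
  antipodal map and \<open>c\<^sub>0\<close> a point. After subdivision no simplex carries two opposite labels of the
  antipodal labelling derived from the cover, and the number of alternating simplices of
  \<open>c\<^sub>j + a c\<^sub>j\<close> is odd for every \<open>j\<close>, so many labels are needed.
\<close>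

section \<open>Alternating labellings\<close>

text \<open>Listed by increasing absolute value, the labels are distinct in absolute value and have signs
  \<open>+, -, +, \<dots>\<close>.\<close>

definition alternating :: "'i set \<Rightarrow> ('i \<Rightarrow> int) \<Rightarrow> bool" where
  "alternating I l \<longleftrightarrow> inj_on (\<lambda>i. \<bar>l i\<bar>) I \<and>
     (\<forall>i\<in>I. 0 < l i \<longleftrightarrow> even (card {j \<in> I. \<bar>l j\<bar> < \<bar>l i\<bar>}))"

lemma alternating_empty [simp]: "alternating {} l"
  by (simp add: alternating_def)

lemma alternating_cong:
  assumes "\<And>i. i \<in> I \<Longrightarrow> l i = l' i"
  shows "alternating I l \<longleftrightarrow> alternating I l'"
proof -
  have "{j \<in> I. \<bar>l j\<bar> < \<bar>l i\<bar>} = {j \<in> I. \<bar>l' j\<bar> < \<bar>l' i\<bar>}" if "i \<in> I" for i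
    using assms that by auto
  moreover have "inj_on (\<lambda>i. \<bar>l i\<bar>) I \<longleftrightarrow> inj_on (\<lambda>i. \<bar>l' i\<bar>) I"
    by (rule inj_on_cong) (simp add: assms)
  ultimately show ?thesis
    using assms by (simp add: alternating_def)
qed

lemma alternating_image:
  assumes "inj_on h I"
  shows "alternating (h ` I) l \<longleftrightarrow> alternating I (l \<circ> h)"
proof -
  have "card {j \<in> h ` I. \<bar>l j\<bar> < \<bar>l (h i)\<bar>} = card {j \<in> I. \<bar>l (h j)\<bar> < \<bar>l (h i)\<bar>}" for i
  proof -
    have "{j \<in> h ` I. \<bar>l j\<bar> < \<bar>l (h i)\<bar>} = h ` {j \<in> I. \<bar>l (h j)\<bar> < \<bar>l (h i)\<bar>}"
      by auto
    then show ?thesis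
      using assms by (simp add: card_image inj_on_subset)
  qed
  moreover have "inj_on (\<lambda>i. \<bar>l i\<bar>) (h ` I) \<longleftrightarrow> inj_on (\<lambda>i. \<bar>l (h i)\<bar>) I"
    using comp_inj_on_iff[OF assms, of "\<lambda>i. \<bar>l i\<bar>"] by (simp add: o_def)
  ultimately show ?thesis
    by (simp add: alternating_def)
qed

text \<open>The largest label comes last in the listing: it leaves the ranks of the others
  unchanged, and its required sign depends only on how many precede it.\<close>

lemma alternating_insert_max:
  assumes "i \<notin> N" and max: "\<And>j. j \<in> N \<Longrightarrow> \<bar>l j\<bar> < \<bar>l i\<bar>"
  shows "alternating (insert i N) l \<longleftrightarrow> alternating N l \<and> (0 < l i \<longleftrightarrow> even (card N))"
proof -
  have "{j \<in> insert i N. \<bar>l j\<bar> < \<bar>l i\<bar>} = N"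
    using assms by auto
  moreover have "{j \<in> insert i N. \<bar>l j\<bar> < \<bar>l k\<bar>} = {j \<in> N. \<bar>l j\<bar> < \<bar>l k\<bar>}" if "k \<in> N" for k
    using max[OF that] by auto
  moreover have "inj_on (\<lambda>i. \<bar>l i\<bar>) (insert i N) \<longleftrightarrow> inj_on (\<lambda>i. \<bar>l i\<bar>) N"
    using assms by (fastforce simp: inj_on_def)
  ultimately show ?thesis
    by (auto simp: alternating_def)
qed

lemma alternating_singleton: "alternating {i} l \<longleftrightarrow> 0 < l i"
  using alternating_insert_max[of i "{}" l] by simp

lemma not_alternating_if_repeated:
  "\<lbrakk>i \<in> I; j \<in> I; i \<noteq> j; l i = l j\<rbrakk> \<Longrightarrow> \<not> alternating I l"
  by (auto simp: alternating_def inj_on_def)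

text \<open>Ky Fan's local step. Remove a vertex with the largest absolute label. If another vertex
  ties with it, their labels agree, so only the two facets omitting one of them can alternate, and
  they do so together. Without a tie, the top label fits behind exactly one parity of predecessors,
  and the claim follows from that for the remaining vertices. The negated labelling stands for
  patterns that begin with \<open>-\<close>.\<close>

lemma odd_card_alternating_facets:
  assumes "finite I" and "\<And>i j. \<lbrakk>i \<in> I; j \<in> I\<rbrakk> \<Longrightarrow> l i \<noteq> - l j"
  shows "odd (card {i \<in> I. alternating (I - {i}) l}) \<longleftrightarrow>
         (alternating I l \<noteq> alternating I (\<lambda>i. - l i))"
  using assms
proof (induction "card I" arbitrary: I)
  case 0
  then show ?case by simp
next
  case (Suc c)
  have "I \<noteq> {}" using Suc.hyps(2) by auto
  obtain i where i: "i \<in> I" and imax: "\<And>j. j \<in> I \<Longrightarrow> \<bar>l j\<bar> \<le> \<bar>l i\<bar>"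
  proof -
    have "Max ((\<lambda>j. \<bar>l j\<bar>) ` I) \<in> (\<lambda>j. \<bar>l j\<bar>) ` I"
      using Suc.prems(1) \<open>I \<noteq> {}\<close> by (intro Max_in) auto
    then obtain i where "i \<in> I" "\<bar>l i\<bar> = Max ((\<lambda>j. \<bar>l j\<bar>) ` I)" by force
    then show thesis using that[of i] Suc.prems(1) by simp
  qed
  define N where "N = I - {i}"
  have N: "finite N" "i \<notin> N" "I = insert i N" "card N = c"
    using Suc.prems(1) Suc.hyps(2) i by (auto simp: N_def)
  show ?case
  proof (cases "\<exists>j\<in>N. \<bar>l j\<bar> = \<bar>l i\<bar>")
    case True
    then obtain j where j: "j \<in> N" "\<bar>l j\<bar> = \<bar>l i\<bar>" by auto
    have ij: "i \<noteq> j" "j \<in> I" using j N by auto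
    have lj: "l j = l i"
      using Suc.prems(2)[OF i ij(2)] j(2) by (auto simp: abs_eq_iff)
    have "\<not> alternating I l" "\<not> alternating I (\<lambda>i. - l i)"
      using not_alternating_if_repeated[OF i ij(2,1)] lj by auto
    have none: "\<not> alternating (I - {k}) l" if "k \<noteq> i" "k \<noteq> j" for k
      by (rule not_alternating_if_repeated[of i _ j]) (use i ij lj that in auto)
    have swap: "alternating (I - {i}) l \<longleftrightarrow> alternating (I - {j}) l"
    proof -
      \<comment> \<open>Exchanging \<open>j\<close> for \<open>i\<close> carries one facet to the
        other and keeps all labels.\<close>
      define h where "h = (\<lambda>k. if k = j then i else k)"
      have "inj_on h (I - {i})" by (auto simp: inj_on_def h_def)
      moreover have "h ` (I - {i}) = I - {j}"
        using i ij by (auto simp: h_def image_iff)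
      moreover have "l \<circ> h = l" using lj by (auto simp: h_def)
      ultimately show ?thesis
        using alternating_image[of h "I - {i}" l] by simp
    qed
    have facets: "{k \<in> I. alternating (I - {k}) l} = {k \<in> {i, j}. alternating (I - {k}) l}"
      using none i ij(2) by blast
    have "even (card {k \<in> {i, j}. alternating (I - {k}) l})"
    proof (cases "alternating (I - {i}) l")
      case True
      then have "{k \<in> {i, j}. alternating (I - {k}) l} = {i, j}"
        using swap by blast
      then show ?thesis using ij(1) by simp
    next
      case False
      then have "{k \<in> {i, j}. alternating (I - {k}) l} = {}"
        using swap by blast
      then show ?thesis by (simp only: card.empty even_zero)
    qed
    then show ?thesis
      unfolding facets using \<open>\<not> alternating I l\<close> \<open>\<not> alternating I (\<lambda>i. - l i)\<close> by blast
  next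
    case False
    then have max: "\<bar>l j\<bar> < \<bar>l i\<bar>" if "j \<in> N" for j
      using imax[of j] that N by fastforce
    \<comment> \<open>The hypothesis applied to \<open>i\<close> twice excludes the label 0, so
      negation really flips the sign condition.\<close>
    have nz: "l i \<noteq> 0"
      using Suc.prems(2)[OF i i] by auto
    have IH: "odd (card {j \<in> N. alternating (N - {j}) l}) \<longleftrightarrow> (alternating N l \<noteq> alternating N (\<lambda>i. - l i))"
      using N Suc.prems(2) by (intro Suc.hyps(1)) auto
    have facet: "alternating (I - {j}) l \<longleftrightarrow> alternating (N - {j}) l \<and> (0 < l i \<longleftrightarrow> odd c)" if "j \<in> N" for j
    proof -
      have "I - {j} = insert i (N - {j})" using that N by auto
      moreover have "even (card (N - {j})) \<longleftrightarrow> odd c"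
        using that N card_Suc_Diff1[of N j] by auto
      ultimately show ?thesis
        using alternating_insert_max[of i "N - {j}" l] N max by simp
    qed
    have "{j \<in> I. alternating (I - {j}) l} =
      (if alternating N l then {i} else {}) \<union> (if 0 < l i \<longleftrightarrow> odd c then {j \<in> N. alternating (N - {j}) l} else {})"
      using facet N by (auto simp: N_def[symmetric])
    then have "card {j \<in> I. alternating (I - {j}) l} =
      (if alternating N l then 1 else 0) + (if 0 < l i \<longleftrightarrow> odd c then card {j \<in> N. alternating (N - {j}) l} else 0)"
      using N by (auto simp: card_insert_if)
    moreover have "alternating I l \<longleftrightarrow> alternating N l \<and> (0 < l i \<longleftrightarrow> even c)"
      using alternating_insert_max[of i N l] N max by simp
    moreover have "alternating I (\<lambda>i. - l i) \<longleftrightarrow> alternating N (\<lambda>i. - l i) \<and> (0 < l i \<longleftrightarrow> odd c)"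
      using alternating_insert_max[of i N "\<lambda>i. - l i"] N max nz by (simp; linarith)
    ultimately show ?thesis
      using IH by (auto split: if_splits)
  qed
qed

lemma not_alternating_few_labels:
  assumes "\<And>i. i \<in> I \<Longrightarrow> \<bar>l i\<bar> \<in> {1..int r}" and "r < card I"
  shows "\<not> alternating I l"
proof
  assume "alternating I l"
  then have "card I = card ((\<lambda>i. \<bar>l i\<bar>) ` I)"
    by (simp add: alternating_def card_image)
  also have "\<dots> \<le> card {1..int r}"
    using assms(1) by (intro card_mono) auto
  finally show False using assms(2) by simp
qed

section \<open>Parity of the number of alternating singular simplices\<close>

text \<open>Parity of the coefficient sum over the simplices satisfying \<open>P\<close>. Extending
  to the free abelian group on one generator makes linearity immediate.\<close>

definition odd_count :: "('s \<Rightarrow> bool) \<Rightarrow> ('s \<Rightarrow>\<^sub>0 int) \<Rightarrow> bool" where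
  "odd_count P c \<longleftrightarrow> odd (Poly_Mapping.lookup (frag_extend (\<lambda>f. if P f then frag_of () else 0) c) ())"

lemma odd_count_0 [simp]: "\<not> odd_count P 0"
  by (simp add: odd_count_def)

lemma odd_count_of [simp]: "odd_count P (frag_of f) \<longleftrightarrow> P f"
  by (simp add: odd_count_def)

lemma odd_count_add: "odd_count P (a + b) \<longleftrightarrow> (odd_count P a \<noteq> odd_count P b)"
  by (simp add: odd_count_def frag_extend_add lookup_add)

lemma odd_count_diff: "odd_count P (a - b) \<longleftrightarrow> (odd_count P a \<noteq> odd_count P b)"
  by (simp add: odd_count_def frag_extend_diff lookup_minus)

lemma odd_count_cmul: "odd_count P (frag_cmul k c) \<longleftrightarrow> odd k \<and> odd_count P c"
  by (simp add: odd_count_def frag_extend_cmul)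

lemma odd_count_sum:
  "finite I \<Longrightarrow> odd_count P (sum c I) \<longleftrightarrow> odd (card {i \<in> I. odd_count P (c i)})"
proof (induction I rule: finite_induct)
  case (insert i I)
  have "{j \<in> insert i I. odd_count P (c j)} =
      (if odd_count P (c i) then insert i {j \<in> I. odd_count P (c j)} else {j \<in> I. odd_count P (c j)})"
    by auto
  then show ?case
    using insert by (simp add: odd_count_add)
qed simp

lemma not_odd_count:
  assumes "\<And>f. f \<in> Poly_Mapping.keys c \<Longrightarrow> \<not> P f"
  shows "\<not> odd_count P c"
proof -
  have "Poly_Mapping.keys c \<subseteq> {f. \<not> P f}" using assms by auto
  then show ?thesis
    by (induction c rule: frag_induction) (auto simp: odd_count_diff)
qed

lemma simplicial_vertex_simplex_map:
  "i \<le> p \<Longrightarrow> simplicial_vertex i (simplex_map p g f) = g (simplicial_vertex i f)"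
  by (simp add: simplicial_vertex_def simplex_map_def)

lemma simplicial_vertex_singular_face:
  assumes "i \<le> p"
  shows "simplicial_vertex i (singular_face (Suc p) k f) =
         simplicial_vertex (if i < k then i else Suc i) f"
proof -
  have "simplical_face k (\<lambda>j. if j = i then 1 else 0 :: real) =
        (\<lambda>j. if j = (if i < k then i else Suc i) then 1 else 0)"
    by (auto simp: simplical_face_def fun_eq_iff)
  then show ?thesis
    using assms by (simp add: simplicial_vertex_def singular_face_def)
qed

definition alternating_simplex :: "('a \<Rightarrow> int) \<Rightarrow> nat \<Rightarrow> ((nat \<Rightarrow> real) \<Rightarrow> 'a) \<Rightarrow> bool" where
  "alternating_simplex lab p f \<longleftrightarrow> alternating {..p} (\<lambda>i. lab (simplicial_vertex i f))"

lemma alternating_singular_face: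
  assumes "k \<le> Suc p"
  shows "alternating_simplex lab p (singular_face (Suc p) k f) \<longleftrightarrow>
         alternating ({..Suc p} - {k}) (\<lambda>i. lab (simplicial_vertex i f))"
proof -
  \<comment> \<open>The order embedding that skips \<open>k\<close>.\<close>
  define h where "h = (\<lambda>i. if i < k then i else Suc i)"
  have "inj_on h {..p}" by (auto simp: inj_on_def h_def)
  moreover have "h ` {..p} = {..Suc p} - {k}"
  proof (intro equalityI subsetI)
    fix j assume j: "j \<in> {..Suc p} - {k}"
    show "j \<in> h ` {..p}"
    proof (cases "j < k")
      case True
      then show ?thesis using j assms by (intro image_eqI[of _ _ j]) (auto simp: h_def)
    next
      case False
      then show ?thesis using j by (intro image_eqI[of _ _ "j - 1"]) (auto simp: h_def)
    qed
  qed (use assms in \<open>auto simp: h_def\<close>)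
  moreover have "alternating_simplex lab p (singular_face (Suc p) k f) \<longleftrightarrow>
      alternating {..p} ((\<lambda>i. lab (simplicial_vertex i f)) \<circ> h)"
    unfolding alternating_simplex_def
    by (rule alternating_cong) (simp add: simplicial_vertex_singular_face h_def)
  ultimately show ?thesis
    using alternating_image[of h "{..p}"] by metis
qed

text \<open>Both sides are linear modulo 2, which reduces the claim to one simplex. There it is the
  facet parity: boundary signs vanish modulo 2, and patterns beginning with \<open>-\<close> are
  those that \<open>a\<close> turns into alternating ones.\<close>

lemma odd_count_alternating_boundary:
  fixes c :: "'a chain"
  assumes antipodal: "\<And>f i. \<lbrakk>f \<in> Poly_Mapping.keys c; i \<le> Suc p\<rbrakk> \<Longrightarrow>
        lab (a (simplicial_vertex i f)) = - lab (simplicial_vertex i f)"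
    and no_compl: "\<And>f i j. \<lbrakk>f \<in> Poly_Mapping.keys c; i \<le> Suc p; j \<le> Suc p\<rbrakk> \<Longrightarrow>
        lab (simplicial_vertex i f) \<noteq> - lab (simplicial_vertex j f)"
  shows "odd_count (alternating_simplex lab p) (chain_boundary (Suc p) c) \<longleftrightarrow>
         (odd_count (alternating_simplex lab (Suc p)) c \<noteq>
          odd_count (alternating_simplex lab (Suc p)) (chain_map (Suc p) a c))"
proof -
  \<comment> \<open>The hypotheses as a set of simplices, so that induction over chains supported in
    it applies.\<close>
  define S where "S = {f :: (nat \<Rightarrow> real) \<Rightarrow> 'a. (\<forall>i\<le>Suc p. lab (a (simplicial_vertex i f)) = - lab (simplicial_vertex i f)) \<and>
     (\<forall>i\<le>Suc p. \<forall>j\<le>Suc p. lab (simplicial_vertex i f) \<noteq> - lab (simplicial_vertex j f))}"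
  have "Poly_Mapping.keys c \<subseteq> S" using assms by (auto simp: S_def)
  then show ?thesis
  proof (induction c rule: frag_induction)
    case (one f)
    let ?l = "\<lambda>i. lab (simplicial_vertex i f)"
    have "odd_count (alternating_simplex lab p) (chain_boundary (Suc p) (frag_of f)) \<longleftrightarrow>
       odd (card {k \<in> {..Suc p}. alternating_simplex lab p (singular_face (Suc p) k f)})"
      by (simp add: chain_boundary_of odd_count_sum odd_count_cmul del: sum.atMost_Suc)
    also have "{k \<in> {..Suc p}. alternating_simplex lab p (singular_face (Suc p) k f)} =
        {k \<in> {..Suc p}. alternating ({..Suc p} - {k}) ?l}"
      by (auto simp: alternating_singular_face simp del: atMost_Suc)
    also have "odd (card \<dots>) \<longleftrightarrow> (alternating {..Suc p} ?l \<noteq> alternating {..Suc p} (\<lambda>i. - ?l i))"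
      using one by (intro odd_card_alternating_facets) (auto simp: S_def)
    also have "alternating {..Suc p} (\<lambda>i. - ?l i) \<longleftrightarrow>
        alternating_simplex lab (Suc p) (simplex_map (Suc p) a f)"
      unfolding alternating_simplex_def using one
      by (intro alternating_cong) (auto simp: simplicial_vertex_simplex_map S_def)
    finally show ?case
      by (simp add: alternating_simplex_def)
  qed (auto simp: odd_count_diff chain_boundary_diff chain_map_diff)
qed

section \<open>Antipodal chains from vanishing homology\<close>

lemma trivial_homology_imp_boundary:
  assumes "trivial_group (homology_group (int p) X)" "singular_chain p X c" "chain_boundary p c = 0"
  obtains d where "singular_chain (Suc p) X d" "chain_boundary (Suc p) d = c"
proof -
  have "homologous_rel_set p X {} c \<in> carrier (homology_group (int p) X)"
    using assms(2,3) by (auto simp: carrier_relative_homology_group singular_cycle)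
  then have "homologous_rel_set p X {} c = singular_relboundary_set p X {}"
    using assms(1) unfolding trivial_group_def by (simp only: one_relative_homology_group singleton_iff)
  then show thesis
    using that by (auto simp: homologous_rel_set_eq_relboundary singular_boundary)
qed

text \<open>Both points have the same image in a one-point space, so the class of their difference
  lies in the kernel that defines reduced homology.\<close>

lemma trivial_reduced_homology_imp_boundary:
  assumes "trivial_group (reduced_homology_group 0 X)" "singular_simplex 0 X f" "singular_simplex 0 X g"
  obtains d where "singular_chain (Suc 0) X d" "chain_boundary (Suc 0) d = frag_of f - frag_of g"
proof -
  let ?c = "frag_of f - frag_of g"
  let ?U = "discrete_topology {()}"
  have c: "singular_chain 0 X ?c"
    using assms by (simp add: singular_chain_diff singular_chain_of)
  have cyc: "singular_relcycle 0 X {} ?c"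
    using c by (simp add: singular_cycle chain_boundary_def)
  have "simplex_map 0 (\<lambda>x. ()) f = simplex_map 0 (\<lambda>x. ()) g"
    by (auto simp: simplex_map_def restrict_def)
  then have "chain_map 0 (\<lambda>x. ()) ?c = 0"
    by (simp add: chain_map_diff)
  then have "hom_induced (int 0) X {} ?U {} (\<lambda>x. ()) (homologous_rel_set 0 X {} ?c)
      = homologous_rel_set 0 ?U {} 0"
    using cyc by (subst hom_induced_chain_map) auto
  also have "\<dots> = \<one>\<^bsub>homology_group (int 0) ?U\<^esub>"
    by (simp only: one_relative_homology_group homologous_rel_set_eq_relboundary singular_relboundary_0)
  finally have "homologous_rel_set 0 X {} ?c \<in> carrier (reduced_homology_group (int 0) X)"
    using cyc unfolding carrier_reduced_homology_group kernel_def
    by (auto simp: carrier_relative_homology_group_0)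
  then have "homologous_rel_set 0 X {} ?c = singular_relboundary_set 0 X {}"
    using assms(1) one_relative_homology_group[of 0 X "{}"]
    by (auto simp: trivial_group_def one_reduced_homology_group)
  then show thesis
    using that by (auto simp: homologous_rel_set_eq_relboundary singular_boundary)
qed

text \<open>Modulo 2, \<open>c j\<close> plays the role of a hemisphere of a \<open>j\<close>-dimensional subsphere.\<close>

definition antipodal_chains :: "'a topology \<Rightarrow> ('a \<Rightarrow> 'a) \<Rightarrow> nat \<Rightarrow> (nat \<Rightarrow> 'a chain) \<Rightarrow> bool" where
  "antipodal_chains X a D c \<longleftrightarrow>
     (\<exists>f. singular_simplex 0 X f \<and> c 0 = frag_of f) \<and>
     (\<forall>j\<le>D. singular_chain j X (c j)) \<and>
     (\<forall>j<D. chain_boundary (Suc j) (c (Suc j)) = c j + frag_cmul ((-1) ^ Suc j) (chain_map j a (c j)))"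

text \<open>Each chain plus its signed antipode is a cycle, because (1 - e a)(1 + e a) = 0 for an
  involution \<open>a\<close> and a sign e; vanishing homology fills this cycle by the next
  chain.\<close>

lemma antipodal_chains_exist:
  assumes x0: "topspace X \<noteq> {}" and a: "continuous_map X X a"
    and inv: "\<And>x. x \<in> topspace X \<Longrightarrow> a (a x) = x"
    and triv: "\<And>p. p < D \<Longrightarrow> trivial_group (reduced_homology_group (int p) X)"
  shows "\<exists>c. antipodal_chains X a D c"
  using triv
proof (induction D)
  case 0
  obtain x where "x \<in> topspace X" using x0 by blast
  then have "singular_simplex 0 X (restrict (\<lambda>_. x) (standard_simplex 0))"
    by (auto simp: singular_simplex_def)
  then show ?case
    by (intro exI[of _ "\<lambda>_. frag_of (restrict (\<lambda>_. x) (standard_simplex 0))"])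
      (auto simp: antipodal_chains_def singular_chain_of)
next
  case (Suc D)
  then obtain c where c: "antipodal_chains X a D c" by auto
  let ?z = "c D + frag_cmul ((-1) ^ Suc D) (chain_map D a (c D))"
  have cD: "singular_chain D X (c D)" using c by (auto simp: antipodal_chains_def)
  have acD: "singular_chain D X (chain_map D a (c D))"
    by (rule singular_chain_chain_map[OF cD a])
  have z: "singular_chain D X ?z"
    by (intro singular_chain_add singular_chain_cmul cD acD)
  \<comment> \<open>For \<open>D = 0\<close> the chain \<open>?z\<close> is a difference of two
    points, which is where reduced homology enters.\<close>
  obtain d where d: "singular_chain (Suc D) X d" "chain_boundary (Suc D) d = ?z"
  proof (cases D)
    case 0
    obtain f where f: "singular_simplex 0 X f" "c 0 = frag_of f"
      using c by (auto simp: antipodal_chains_def)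
    have "trivial_group (reduced_homology_group 0 X)" using Suc.prems[of 0] by simp
    moreover have "singular_simplex 0 X (simplex_map 0 a f)"
      by (rule singular_simplex_simplex_map[OF f(1) a])
    ultimately obtain d where "singular_chain (Suc 0) X d"
        "chain_boundary (Suc 0) d = frag_of f - frag_of (simplex_map 0 a f)"
      using trivial_reduced_homology_imp_boundary f(1) by metis
    then show thesis using that[of d] 0 f by simp
  next
    case (Suc E)
    let ?cE = "c E" let ?b = "chain_map E a ?cE"
    have cE: "singular_chain E X ?cE" using c Suc by (auto simp: antipodal_chains_def)
    have bd: "chain_boundary D (c D) = ?cE + frag_cmul ((-1) ^ D) ?b"
      using c Suc by (auto simp: antipodal_chains_def)
    have "chain_map E a ?b = chain_map E (a \<circ> a) ?cE"
      by (simp add: chain_map_compose)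
    also have "\<dots> = ?cE"
      using cE inv by (intro chain_map_id_gen) auto
    finally have aa: "chain_map E a ?b = ?cE" .
    have "chain_boundary D ?z = chain_boundary D (c D) + frag_cmul ((-1) ^ Suc D) (chain_map E a (chain_boundary D (c D)))"
      using chain_boundary_chain_map[OF cD, of a] Suc
      by (simp add: chain_boundary_add chain_boundary_cmul)
    also have "\<dots> = 0"
      unfolding bd by (cases "even D") (simp_all add: chain_map_add chain_map_diff aa)
    finally have "chain_boundary D ?z = 0" .
    moreover have "trivial_group (homology_group (int D) X)"
      using Suc.prems[of D] Suc by (simp add: un_reduced_homology_group)
    ultimately show thesis
      using trivial_homology_imp_boundary[OF _ z] that by blast
  qed
  have "antipodal_chains X a (Suc D) (c(Suc D := d))"
    using c d by (auto simp: antipodal_chains_def le_Suc_eq less_Suc_eq)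
  then show ?case by blast
qed

text \<open>Subdivision commutes with the boundary and with \<open>a\<close>, and it fixes
  0-simplices.\<close>

lemma antipodal_chains_subdivision:
  assumes "antipodal_chains X a D c" "continuous_map X X a"
  shows "antipodal_chains X a D (\<lambda>j. singular_subdivision j (c j))"
proof -
  obtain f where f: "singular_simplex 0 X f" "c 0 = frag_of f"
    using assms by (auto simp: antipodal_chains_def)
  have "singular_subdivision 0 (c 0) = frag_of f"
    using f singular_subdivision_zero[of X "frag_of f"] by (simp add: singular_chain_of)
  moreover have "singular_chain j X (singular_subdivision j (c j))" if "j \<le> D" for j
    using assms that by (auto simp: antipodal_chains_def intro: singular_chain_singular_subdivision)
  moreover have "chain_boundary (Suc j) (singular_subdivision (Suc j) (c (Suc j))) =
      singular_subdivision j (c j) + frag_cmul ((-1) ^ Suc j) (chain_map j a (singular_subdivision j (c j)))"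
    if "j < D" for j
  proof -
    have *: "singular_chain j X (c j)" "singular_chain (Suc j) X (c (Suc j))"
        "chain_boundary (Suc j) (c (Suc j)) = c j + frag_cmul ((-1) ^ Suc j) (chain_map j a (c j))"
      using assms that by (auto simp: antipodal_chains_def)
    have "singular_subdivision j (frag_cmul k e) = frag_cmul k (singular_subdivision j e)" for k and e :: "'a chain"
      by (simp add: singular_subdivision_def frag_extend_cmul)
    then show ?thesis
      using chain_boundary_singular_subdivision[OF *(2)] naturality_singular_subdivision[OF *(1), of a] *(3)
      by (simp add: singular_subdivision_add del: power_Suc)
  qed
  ultimately show ?thesis
    using f(1) by (auto simp: antipodal_chains_def)
qed

lemma antipodal_chains_iterated_subdivision:
  assumes "antipodal_chains X a D c" "continuous_map X X a"
  shows "antipodal_chains X a D (\<lambda>j. (singular_subdivision j ^^ n) (c j))"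
proof (induction n)
  case (Suc n)
  then show ?case
    using antipodal_chains_subdivision[OF Suc assms(2)] by simp
qed (use assms in simp)

text \<open>A Tucker lemma for singular chains: the parity count yields an alternating
  \<open>D\<close>-simplex, hence \<open>D + 1\<close> distinct absolute labels. The cover \<C>
  replaces a triangulation: a simplex inside one of its members carries no opposite labels.\<close>

theorem antipodal_labelling_bound:
  assumes x0: "topspace X \<noteq> {}" and a: "continuous_map X X a"
    and inv: "\<And>x. x \<in> topspace X \<Longrightarrow> a (a x) = x"
    and triv: "\<And>p. p < D \<Longrightarrow> trivial_group (reduced_homology_group (int p) X)"
    and opn: "\<And>V. V \<in> \<C> \<Longrightarrow> openin X V" and cov: "topspace X \<subseteq> \<Union>\<C>"
    and antipodal: "\<And>x. x \<in> topspace X \<Longrightarrow> lab (a x) = - lab x"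
    and no_compl: "\<And>V x y. \<lbrakk>V \<in> \<C>; x \<in> V; y \<in> V\<rbrakk> \<Longrightarrow> lab x \<noteq> - lab y"
    and range: "\<And>x. x \<in> topspace X \<Longrightarrow> \<bar>lab x\<bar> \<in> {1..int r}"
  shows "D < r"
proof (rule ccontr)
  assume "\<not> D < r"
  obtain c where c: "antipodal_chains X a D c"
    using antipodal_chains_exist[OF x0 a inv triv] by blast
  have "\<exists>n. \<forall>m f. n \<le> m \<and> f \<in> Poly_Mapping.keys ((singular_subdivision j ^^ m) (c j)) \<longrightarrow>
      (\<exists>V\<in>\<C>. f \<in> standard_simplex j \<rightarrow> V)" if "j \<le> D" for j
  proof -
    have "singular_chain j X (c j)" using c that by (auto simp: antipodal_chains_def)
    from sufficient_iterated_singular_subdivision_exists[OF opn cov this] show ?thesis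
      by metis
  qed
  then obtain N where N: "\<And>j m f. \<lbrakk>j \<le> D; N j \<le> m; f \<in> Poly_Mapping.keys ((singular_subdivision j ^^ m) (c j))\<rbrakk>
      \<Longrightarrow> \<exists>V\<in>\<C>. f \<in> standard_simplex j \<rightarrow> V"
    by metis
  \<comment> \<open>One number of subdivisions for all degrees preserves the boundary relations
    between consecutive chains.\<close>
  define M where "M = Max (N ` {..D})"
  define s where "s = (\<lambda>j. (singular_subdivision j ^^ M) (c j))"
  have small: "\<exists>V\<in>\<C>. f \<in> standard_simplex j \<rightarrow> V" if "j \<le> D" "f \<in> Poly_Mapping.keys (s j)" for j f
    using N[of j M f] that by (auto simp: M_def s_def)
  have s: "antipodal_chains X a D s"
    unfolding s_def by (rule antipodal_chains_iterated_subdivision[OF c a])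
  have vertex: "simplicial_vertex i f \<in> topspace X" if "j \<le> D" "f \<in> Poly_Mapping.keys (s j)" "i \<le> j" for i j f
  proof -
    have "singular_simplex j X f"
      using s that by (auto simp: antipodal_chains_def singular_chain_def)
    then show ?thesis
      using that(3) by (auto simp: singular_simplex_def simplicial_vertex_def continuous_map_def)
  qed
  \<comment> \<open>Oddness passes upward: modulo 2 the boundary of \<open>s (Suc j)\<close> is
    \<open>s j\<close> plus its antipode, and its count equals that of \<open>s (Suc j)\<close> plus
    its antipode.\<close>
  have step: "odd_count (alternating_simplex lab j) (s j) \<noteq>
      odd_count (alternating_simplex lab j) (chain_map j a (s j))" if "j \<le> D" for j
    using that
  proof (induction j)
    case 0
    obtain f where f: "singular_simplex 0 X f" "s 0 = frag_of f"
      using s by (auto simp: antipodal_chains_def)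
    let ?v = "simplicial_vertex 0 f"
    have v: "?v \<in> topspace X" using vertex[of 0 f 0] f by simp
    \<comment> \<open>Of a point and its antipode, exactly one has a positive label.\<close>
    have "{..0::nat} = {0}" by auto
    then show ?case
      using antipodal[OF v] range[OF v] by (auto simp: f alternating_simplex_def alternating_singleton simplicial_vertex_simplex_map)
  next
    case (Suc j)
    have "odd_count (alternating_simplex lab j) (chain_boundary (Suc j) (s (Suc j))) \<longleftrightarrow>
         (odd_count (alternating_simplex lab (Suc j)) (s (Suc j)) \<noteq>
          odd_count (alternating_simplex lab (Suc j)) (chain_map (Suc j) a (s (Suc j))))"
    proof (rule odd_count_alternating_boundary)
      fix f i assume "f \<in> Poly_Mapping.keys (s (Suc j))" "i \<le> Suc j"
      then show "lab (a (simplicial_vertex i f)) = - lab (simplicial_vertex i f)"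
        using vertex antipodal Suc.prems by auto
    next
      fix f i k assume f: "f \<in> Poly_Mapping.keys (s (Suc j))" and ik: "i \<le> Suc j" "k \<le> Suc j"
      obtain V where "V \<in> \<C>" "f \<in> standard_simplex (Suc j) \<rightarrow> V"
        using small[OF Suc.prems f] by auto
      then show "lab (simplicial_vertex i f) \<noteq> - lab (simplicial_vertex k f)"
        using ik by (intro no_compl) (auto simp: simplicial_vertex_def)
    qed
    moreover have "chain_boundary (Suc j) (s (Suc j)) = s j + frag_cmul ((-1) ^ Suc j) (chain_map j a (s j))"
      using s Suc.prems by (auto simp: antipodal_chains_def)
    ultimately show ?case
      using Suc by (simp add: odd_count_add odd_count_cmul del: power_Suc)
  qed
  have none: "\<not> odd_count (alternating_simplex lab D) e" if e: "singular_chain D X e" for e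
  proof (rule not_odd_count)
    fix f assume "f \<in> Poly_Mapping.keys e"
    then have "singular_simplex D X f" using e by (auto simp: singular_chain_def)
    then have "simplicial_vertex i f \<in> topspace X" if "i \<le> D" for i
      using that by (auto simp: singular_simplex_def simplicial_vertex_def continuous_map_def)
    then show "\<not> alternating_simplex lab D f"
      unfolding alternating_simplex_def using range \<open>\<not> D < r\<close>
      by (intro not_alternating_few_labels[of _ _ r]) auto
  qed
  have "singular_chain D X (s D)" using s by (auto simp: antipodal_chains_def)
  then show False
    using step[of D] none singular_chain_chain_map[OF _ a] by blast
qed

section \<open>Multiple antipodal covers\<close>

text \<open>Spans of orthonormal sets make subspheres such as the equator available inside one
  type.\<close>

lemma trivial_reduced_homology_group_sphere:
  fixes B :: "'a::euclidean_space set"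
  assumes "independent B" "pairwise orthogonal B" "\<And>u. u \<in> B \<Longrightarrow> norm u = 1"
    and "card B = Suc D" and "p < D"
  shows "trivial_group (reduced_homology_group (int p) (top_of_set (sphere 0 1 \<inter> span B)))"
proof -
  obtain f :: "(nat \<Rightarrow> real) \<Rightarrow> 'a" and g
    where "homeomorphic_maps (nsphere D) (top_of_set (sphere 0 1 \<inter> span B)) f g"
    using homeomorphic_maps_nsphere_euclidean_sphere[of B "Suc D"] assms(1-4) by auto
  then have "nsphere D homeomorphic_space top_of_set (sphere 0 1 \<inter> span B)"
    unfolding homeomorphic_space_def by blast
  then show ?thesis
    using isomorphic_group_triviality1[OF homeomorphic_space_imp_isomorphic_reduced_homology_groups]
      trivial_reduced_homology_group_nsphere[of "int p" D] assms(5) by simp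
qed

text \<open>Label a point by the first \<open>i\<close> such that it or its antipode lies deep
  inside \<open>A i\<close>, the sign telling which of the two. Depth is measured by a Lebesgue
  number, so nearby points never get opposite labels.\<close>

theorem lusternik_schnirelmann_open:
  fixes B :: "'a::euclidean_space set" and A :: "nat \<Rightarrow> 'a set"
  defines "S \<equiv> sphere 0 1 \<inter> span B"
  assumes B: "independent B" "pairwise orthogonal B" "\<And>u. u \<in> B \<Longrightarrow> norm u = 1" "card B = Suc D"
    and opn: "\<And>i. i \<le> r \<Longrightarrow> openin (top_of_set S) (A i)"
    and antipodal: "\<And>i x. \<lbrakk>i \<le> r; x \<in> A i\<rbrakk> \<Longrightarrow> - x \<notin> A i"
    and cov: "S \<subseteq> (\<Union>i\<le>r. A i)"
  shows "D < r"
proof -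
  obtain G where G: "\<And>i. i \<le> r \<Longrightarrow> open (G i) \<and> A i = S \<inter> G i"
    using opn unfolding openin_open by metis
  have "compact S"
    unfolding S_def by (intro compact_Int_closed compact_sphere closed_subspace subspace_span)
  moreover have "S \<subseteq> \<Union> (G ` {..r})"
    using cov G by fastforce
  moreover have "open H" if "H \<in> G ` {..r}" for H
    using that G by auto
  ultimately obtain e where e: "0 < e" "\<And>x. x \<in> S \<Longrightarrow> \<exists>H\<in>G ` {..r}. ball x e \<subseteq> H"
    by (metis Heine_Borel_lemma)
  have minus: "- x \<in> S" if "x \<in> S" for x
    using that by (auto simp: S_def span_neg)
  \<comment> \<open>With \<open>e\<close> a Lebesgue number, the shrunken sets \<open>F i\<close>
    still cover \<open>S\<close>, while all points of \<open>S\<close> closer than \<open>e\<close>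
    to \<open>F i\<close> lie in \<open>A i\<close>.\<close>
  define F where "F = (\<lambda>i. {x \<in> S. ball x e \<subseteq> G i})"
  have FA: "y \<in> A i" if "i \<le> r" "x \<in> F i" "y \<in> S" "dist x y < e" for i x y
    using that G by (auto simp: F_def)
  have F_antipodal: "- x \<notin> F i" if "i \<le> r" "x \<in> F i" for i x
    using FA[OF that, of x] FA[of i "- x" "- x"] antipodal[of i x] that e(1) by (auto simp: F_def)
  have F_cov: "\<exists>i\<le>r. x \<in> F i" if "x \<in> S" for x
    using e(2)[OF that] that by (auto simp: F_def)
  \<comment> \<open>\<open>r\<close> labels suffice for the \<open>r + 1\<close> sets: a point in none of \<open>\<plusminus> F i\<close>, \<open>i < r\<close>, would lie in
      both \<open>F r\<close> and \<open>- F r\<close>.\<close>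
  define P where "P = (\<lambda>x i. x \<in> F i \<or> - x \<in> F i)"
  define idx where "idx = (\<lambda>x. LEAST i. P x i)"
  \<comment> \<open>The summand 1 keeps labels away from 0.\<close>
  define lab where "lab = (\<lambda>x. (if x \<in> F (idx x) then 1 else -1) * (int (idx x) + 1))"
  have idx: "P x (idx x)" "idx x < r" if xS: "x \<in> S" for x
  proof -
    obtain i j where ij: "i \<le> r" "x \<in> F i" "j \<le> r" "- x \<in> F j"
      using F_cov[OF xS] F_cov[OF minus[OF xS]] by blast
    then have "i \<noteq> j" using F_antipodal by auto
    then have "P x (min i j)" "min i j < r" using ij by (auto simp: P_def min_def)
    then show "P x (idx x)" "idx x < r"
      unfolding idx_def by (auto intro: LeastI Least_le[THEN le_less_trans])
  qed
  have idx_minus: "idx (- x) = idx x" for x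
    by (simp add: idx_def P_def disj_commute)
  let ?X = "top_of_set S"
  \<comment> \<open>Balls of radius \<open>e / 2\<close> keep any two points of one set closer than
    \<open>e\<close>.\<close>
  show ?thesis
  proof (rule antipodal_labelling_bound[where X = ?X and a = uminus and lab = lab
        and \<C> = "(\<lambda>z. S \<inter> ball z (e / 2)) ` S"])
    have "B \<noteq> {}" using B(4) by auto
    then obtain u where "u \<in> B" by blast
    then have "u \<in> S" using B(3) by (auto simp: S_def span_base)
    then show "topspace ?X \<noteq> {}" by auto
    show "continuous_map ?X ?X uminus"
      using minus by (auto simp: continuous_map_in_subtopology intro!: continuous_intros)
    show "trivial_group (reduced_homology_group (int p) ?X)" if "p < D" for p
      unfolding S_def by (rule trivial_reduced_homology_group_sphere[OF B that])
    show "topspace ?X \<subseteq> \<Union> ((\<lambda>z. S \<inter> ball z (e / 2)) ` S)"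
      using e(1) by auto
    show "openin ?X V" if "V \<in> (\<lambda>z. S \<inter> ball z (e / 2)) ` S" for V
      using that by (auto intro: openin_open_Int)
    show "lab (- x) = - lab x" if "x \<in> topspace ?X" for x
      using idx[of x] F_antipodal[of "idx x" x] F_antipodal[of "idx x" "- x"] that
      by (auto simp: lab_def idx_minus P_def)
    show "\<bar>lab x\<bar> \<in> {1..int r}" if "x \<in> topspace ?X" for x
      using idx[of x] that by (auto simp: lab_def)
    show "lab x \<noteq> - lab y" if V: "V \<in> (\<lambda>z. S \<inter> ball z (e / 2)) ` S" "x \<in> V" "y \<in> V" for V x y
    proof
      assume eq: "lab x = - lab y"
      obtain z where "dist z x < e / 2" "dist z y < e / 2" and S: "x \<in> S" "y \<in> S"
        using V by fastforce
      then have d: "dist x y < e" "dist y x < e"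
        by (metis dist_commute dist_triangle_half_r)+
      have same: "idx x = idx y"
        using eq by (auto simp: lab_def split: if_splits)
      \<comment> \<open>Closeness to \<open>u\<close> puts \<open>v\<close> into \<open>A i\<close>,
        which already contains \<open>- v\<close>.\<close>
      have far: False if "i \<le> r" "u \<in> F i" "- v \<in> F i" "v \<in> S" "dist u v < e" for i u v
        using FA[of i u v] FA[of i "- v" "- v"] antipodal[of i v] that e(1) by (auto simp: F_def)
      show False
        using eq idx[OF S(1)] idx[OF S(2)] S d far[of "idx x" x y] far[of "idx x" y x] same
        by (auto simp: lab_def P_def split: if_splits)
    qed
  qed auto
qed

text \<open>A point outside the first \<open>r\<close> sets has all its memberships among the
  remaining ones, so the set of points lying in \<open>m\<close> of these completes a cover by
  \<open>r + 1\<close> antipodal sets.\<close>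

theorem multiple_cover_bound:
  fixes B :: "'a::euclidean_space set" and U :: "nat \<Rightarrow> 'a set"
  defines "S \<equiv> sphere 0 1 \<inter> span B"
  assumes B: "independent B" "pairwise orthogonal B" "\<And>u. u \<in> B \<Longrightarrow> norm u = 1" "card B = Suc D"
    and opn: "\<And>i. i < k \<Longrightarrow> openin (top_of_set S) (U i)"
    and antipodal: "\<And>i x. \<lbrakk>i < k; x \<in> U i\<rbrakk> \<Longrightarrow> - x \<notin> U i"
    and cov: "\<And>x. x \<in> S \<Longrightarrow> m \<le> card {i. i < k \<and> x \<in> U i}" and "1 \<le> m"
  shows "D + 2 * m \<le> k"
proof -
  \<comment> \<open>The indices of sets containing \<open>x\<close> and of those containing
    \<open>- x\<close> are disjoint.\<close>
  have disj: "2 * m \<le> card J" if "finite J" "J \<subseteq> {..<k}"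
      "m \<le> card {j \<in> J. x \<in> U j}" "m \<le> card {j \<in> J. - x \<in> U j}" for x J
  proof -
    have "{j \<in> J. x \<in> U j} \<inter> {j \<in> J. - x \<in> U j} = {}"
      using antipodal that(2) by auto
    then have "card {j \<in> J. x \<in> U j} + card {j \<in> J. - x \<in> U j} = card ({j \<in> J. x \<in> U j} \<union> {j \<in> J. - x \<in> U j})"
      using that(1) by (subst card_Un_disjoint) auto
    also have "\<dots> \<le> card J" using that(1) by (intro card_mono) auto
    finally show ?thesis using that by linarith
  qed
  have "B \<noteq> {}" using B(4) by auto
  then obtain u where "u \<in> B" by blast
  then have u: "u \<in> S" "- u \<in> S" using B(3) by (auto simp: S_def span_base span_neg)
  have "2 * m \<le> k"
    using disj[of "{..<k}" u] cov[OF u(1)] cov[OF u(2)] by simp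
  \<comment> \<open>Exactly \<open>2 * m - 1\<close> indices remain in \<open>{r..<k}\<close>, one
    too few for \<open>disj\<close>.\<close>
  define r where "r = k + 1 - 2 * m"
  have r: "r + 2 * m = k + 1" using \<open>2 * m \<le> k\<close> by (simp add: r_def)
  define A where "A = (\<lambda>i. if i < r then U i else {x \<in> S. m \<le> card {j \<in> {r..<k}. x \<in> U j}})"
  have "D < r"
  proof (rule lusternik_schnirelmann_open[where A = A, OF B], unfold S_def[symmetric])
    fix i assume "i \<le> r"
    show "openin (top_of_set S) (A i)"
    proof (cases "i < r")
      case True
      then show ?thesis using opn[of i] r \<open>1 \<le> m\<close> by (simp add: A_def)
    next
      case False
      \<comment> \<open>Openness: a finite intersection for each choice of \<open>m\<close> indices.
        Since \<open>m\<close> is positive, no intersection is empty-indexed, so all stay inside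
        \<open>S\<close>.\<close>
      have "{x \<in> S. m \<le> card {j \<in> {r..<k}. x \<in> U j}} = \<Union> ((\<lambda>J. \<Inter> (U ` J)) ` {J. J \<subseteq> {r..<k} \<and> card J = m})"
        (is "?L = \<Union> (_ ` ?\<J>)")
      proof (intro equalityI subsetI)
        fix x assume "x \<in> ?L"
        then obtain J where "J \<subseteq> {j \<in> {r..<k}. x \<in> U j}" "card J = m"
          by (auto elim: obtain_subset_with_card_n)
        then have "J \<in> ?\<J>" "x \<in> \<Inter> (U ` J)" by auto
        then show "x \<in> \<Union> ((\<lambda>J. \<Inter> (U ` J)) ` ?\<J>)" by blast
      next
        fix x assume "x \<in> \<Union> ((\<lambda>J. \<Inter> (U ` J)) ` ?\<J>)"
        then obtain J where J: "J \<subseteq> {r..<k}" "card J = m" "\<forall>j\<in>J. x \<in> U j" by auto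
        then have "J \<noteq> {}" using \<open>1 \<le> m\<close> by auto
        then obtain j where "j \<in> J" by auto
        then have "j < k" "x \<in> U j" using J by auto
        then have "x \<in> S" using openin_imp_subset[OF opn] by blast
        moreover have "card J \<le> card {j \<in> {r..<k}. x \<in> U j}"
          using J by (intro card_mono) auto
        ultimately show "x \<in> ?L" using J by simp
      qed
      moreover have "openin (top_of_set S) (\<Inter> (U ` J))" if "J \<in> ?\<J>" for J
        using that opn \<open>1 \<le> m\<close> finite_subset[of J "{r..<k}"] by (intro openin_Inter) auto
      ultimately show ?thesis
        using False by (auto simp: A_def)
    qed
    fix x assume x: "x \<in> A i"
    show "- x \<notin> A i"
    proof (cases "i < r")
      case True
      then show ?thesis using antipodal[of i x] x r \<open>1 \<le> m\<close> by (simp add: A_def)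
    next
      case False
      have sub: "{r..<k} \<subseteq> {..<k}" by auto
      show ?thesis
      proof
        assume "- x \<in> A i"
        then have "m \<le> card {j \<in> {r..<k}. x \<in> U j}" "m \<le> card {j \<in> {r..<k}. - x \<in> U j}"
          using x False unfolding A_def by simp_all
        then have "2 * m \<le> card {r..<k}"
          by (rule disj[OF finite_atLeastLessThan sub])
        then show False using r \<open>1 \<le> m\<close> by simp
      qed
    qed
  next
    show "S \<subseteq> (\<Union>i\<le>r. A i)"
    proof
      fix x assume x: "x \<in> S"
      show "x \<in> (\<Union>i\<le>r. A i)"
      proof (cases "\<exists>i<r. x \<in> U i")
        case True
        then show ?thesis by (auto simp: A_def)
      next
        case False
        then have "{j \<in> {r..<k}. x \<in> U j} = {i. i < k \<and> x \<in> U i}"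
          by (auto simp: not_less)
        then have "x \<in> A r" using cov[OF x] x by (simp add: A_def)
        then show ?thesis by auto
      qed
    qed
  qed
  then show ?thesis using r by linarith
qed

text \<open>The equator is a sphere of dimension \<open>d - 1\<close> that is closed under antipodes
  and contained in the closed northern hemisphere, so the cover is \<open>m\<close>-fold on all of
  it.\<close>

lemma antipodal_bar_open_cover_bound:
  fixes b :: "'a::euclidean_space"
  assumes dim: "DIM('a) = d + 1" "1 \<le> d" and "1 \<le> m" "b \<in> Basis"
    and U: "antipodal_bar_open_cover b n m k U"
  shows "d + 2 * m - 1 \<le> k"
proof -
  let ?B = "Basis - {b}" let ?S = "sphere 0 1 \<inter> span (Basis - {b})"
  have equator: "x \<bullet> b = 0" if "x \<in> span ?B" for x
    using that
  proof (induction rule: span_induct_alt)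
    case (step c y z)
    then show ?case using \<open>b \<in> Basis\<close> by (auto simp: inner_add_left inner_Basis)
  qed simp
  have "(d - 1) + 2 * m \<le> k"
  proof (rule multiple_cover_bound[of ?B, where U = "\<lambda>i. ?S \<inter> U i"])
    show "independent ?B" by (rule independent_mono[OF independent_Basis]) auto
    show "pairwise orthogonal ?B" by (rule pairwise_mono[OF orthogonal_Basis]) auto
    show "card ?B = Suc (d - 1)" using dim \<open>b \<in> Basis\<close> by (simp add: card_Diff_singleton)
    show "openin (top_of_set ?S) (?S \<inter> U i)" if "i < k" for i
    proof -
      have "openin (top_of_set (sphere 0 1)) (U i)"
        using U that by (simp add: antipodal_bar_open_cover_def)
      then obtain T where "open T" "U i = sphere 0 1 \<inter> T"
        by (auto simp: openin_open)
      then have "?S \<inter> U i = ?S \<inter> T" by auto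
      then show ?thesis using \<open>open T\<close> by (simp add: openin_open_Int)
    qed
    show "- x \<notin> ?S \<inter> U i" if "i < k" "x \<in> ?S \<inter> U i" for i x
      using U that by (auto simp: antipodal_bar_open_cover_def)
    show "m \<le> card {i. i < k \<and> x \<in> ?S \<inter> U i}" if "x \<in> ?S" for x
      using U that equator[of x] by (auto simp: antipodal_bar_open_cover_def)
  qed (use \<open>1 \<le> m\<close> in auto)
  then show ?thesis using \<open>1 \<le> d\<close> by simp
qed

section \<open>Sign alternation of polynomials and Gale's points\<close>

definition rank_in :: "real set \<Rightarrow> real \<Rightarrow> nat" where
  "rank_in T t = card {u \<in> T. u < t}"

text \<open>Ranks run through 0, ..., \<open>card T - 1\<close>; half of them, rounded up, are
  even.\<close>

lemma card_even_rank:
  assumes "finite T"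
  shows "2 * card {t \<in> T. even (rank_in T t)} = card T + card T mod 2"
  using assms
proof (induction T rule: finite_linorder_max_induct)
  case (insert t T)
  have "rank_in (insert t T) u = rank_in T u" if "u \<in> T" for u
    using insert.hyps(2) that unfolding rank_in_def by (intro arg_cong[of _ _ card]) auto
  moreover have "rank_in (insert t T) t = card T"
    using insert.hyps(2) unfolding rank_in_def by (intro arg_cong[of _ _ card]) auto
  moreover have "t \<notin> T" using insert.hyps by auto
  ultimately have "{u \<in> insert t T. even (rank_in (insert t T) u)} =
      {u \<in> T. even (rank_in T u)} \<union> (if even (card T) then {t} else {})"
    by auto
  then have "card {u \<in> insert t T. even (rank_in (insert t T) u)} =
      card {u \<in> T. even (rank_in T u)} + (if even (card T) then 1 else 0)"
    using \<open>t \<notin> T\<close> \<open>finite T\<close> by auto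
  then show ?case
    using insert.IH \<open>t \<notin> T\<close> \<open>finite T\<close> by (auto simp: mod2_eq_if)
qed simp

text \<open>Without a root, \<open>p\<close> has constant sign and the alternating factor makes at
  least half of the points, rounded down, positive. Otherwise divide out a root and discard one
  point next to it; degree and \<open>card T\<close> both drop by one. A general \<epsilon> lets the
  induction flip the sign.\<close>

lemma card_alternating_poly_pos:
  fixes p :: "real poly"
  assumes "finite T" "p \<noteq> 0" "\<epsilon> \<noteq> 0"
  shows "card T \<le> 2 * card {t \<in> T. 0 < \<epsilon> * (-1) ^ rank_in T t * poly p t} + degree p + 1"
  using assms
proof (induction "degree p" arbitrary: p T \<epsilon> rule: less_induct)
  case less
  show ?case
  proof (cases "\<exists>z. poly p z = 0")
    case False
    have same_sign: "0 < poly p s * poly p t" if "s < t" for s t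
      using poly_IVT[of s t p] False that by (metis mult_eq_0_iff not_less_iff_gr_or_eq)
    have sgn: "sgn (poly p t) = sgn (poly p 0)" for t
      using same_sign[of t 0] same_sign[of 0 t] False
      by (cases t "0::real" rule: linorder_cases) (auto simp: sgn_if zero_less_mult_iff)
    have pos: "0 < \<epsilon> * (-1) ^ k * poly p t \<longleftrightarrow> (even k \<longleftrightarrow> 0 < \<epsilon> * poly p 0)" for k t
    proof -
      have "poly p 0 \<noteq> 0" "poly p t \<noteq> 0" using False by auto
      then show ?thesis
        using sgn[of t] less.prems(3)
        by (cases "even k"; auto simp: sgn_if zero_less_mult_iff mult_less_0_iff split: if_splits)
    qed
    have "card T = card {t \<in> T. even (rank_in T t)} + card {t \<in> T. odd (rank_in T t)}"
      using less.prems(1) by (subst card_Un_disjoint[symmetric]) (auto intro: arg_cong[of _ _ card])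
    then show ?thesis
      using card_even_rank[OF less.prems(1)] unfolding pos
      by (cases "0 < \<epsilon> * poly p 0") auto
  next
    case True
    then obtain z where z: "poly p z = 0" by auto
    then obtain q where q: "p = [:- z, 1:] * q"
      by (metis dvdE poly_eq_0_iff_dvd)
    have "q \<noteq> 0" using less.prems(2) q by auto
    then have deg: "degree p = Suc (degree q)"
      by (simp add: q degree_mult_eq del: mult_pCons_left)
    show ?thesis
    proof (cases "T = {}")
      case False
      \<comment> \<open>\<open>s\<close> is the first point not left of \<open>z\<close>, or the
        last point of \<open>T\<close> if there is none; it separates the other points just as
        \<open>z\<close> does.\<close>
      obtain s where s: "s \<in> T" "\<And>t. t \<in> T \<Longrightarrow> t < s \<Longrightarrow> t < z" "\<And>t. t \<in> T \<Longrightarrow> s < t \<Longrightarrow> z < t"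
      proof (cases "\<exists>t\<in>T. z \<le> t")
        case True
        let ?s = "Min {t \<in> T. z \<le> t}"
        have "?s \<in> {t \<in> T. z \<le> t}" using True less.prems(1) by (intro Min_in) auto
        moreover have "?s \<le> t" if "t \<in> T" "z \<le> t" for t using that less.prems(1) by (intro Min_le) auto
        ultimately show thesis
          by (intro that[of ?s]) (auto simp: not_le[symmetric] dest: order.trans)
      next
        case no: False
        have max: "Max T \<in> T" using less.prems(1) False by simp
        show thesis
        proof (rule that[OF max])
          fix t assume t: "t \<in> T"
          then show "t < z" using no by (auto simp: not_le)
          have "t \<le> Max T" using t less.prems(1) by simp
          then show "z < t" if "Max T < t" using that by simp
        qed
      qed
      have fin: "finite (T - {s})" using less.prems(1) by simp
      \<comment> \<open>Left of \<open>s\<close> the factor \<open>t - z\<close> is negative and the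
        rank is unchanged; right of \<open>s\<close> the factor is positive and the rank drops by
        one. Either way the sign flips once, which \<open>- \<epsilon>\<close> absorbs.\<close>
      have sign: "0 < - \<epsilon> * (-1) ^ rank_in (T - {s}) t * poly q t \<longleftrightarrow> 0 < \<epsilon> * (-1) ^ rank_in T t * poly p t"
        if t: "t \<in> T - {s}" for t
      proof (cases "t < s")
        case True
        then have "rank_in (T - {s}) t = rank_in T t"
          unfolding rank_in_def by (intro arg_cong[of _ _ card]) auto
        moreover have "t - z < 0" using s(2)[of t] True t by auto
        moreover have "poly p t = (t - z) * poly q t" by (simp add: q algebra_simps)
        ultimately show ?thesis
          by (auto simp: zero_less_mult_iff mult_less_0_iff)
      next
        case False
        then have "s < t" using t by auto
        then have "{u \<in> T. u < t} = insert s {u \<in> T - {s}. u < t}" using s by auto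
        then have "rank_in T t = Suc (rank_in (T - {s}) t)"
          using fin by (simp add: rank_in_def)
        moreover have "0 < t - z" using s(3)[of t] \<open>s < t\<close> t by auto
        moreover have "poly p t = (t - z) * poly q t" by (simp add: q algebra_simps)
        ultimately show ?thesis
          by (auto simp: zero_less_mult_iff mult_less_0_iff)
      qed
      have "card (T - {s}) \<le> 2 * card {t \<in> T - {s}. 0 < - \<epsilon> * (-1) ^ rank_in (T - {s}) t * poly q t} + degree q + 1"
        using less.hyps[of q "T - {s}" "- \<epsilon>"] deg fin \<open>q \<noteq> 0\<close> less.prems(3) by simp
      also have "card {t \<in> T - {s}. 0 < - \<epsilon> * (-1) ^ rank_in (T - {s}) t * poly q t}
          \<le> card {t \<in> T. 0 < \<epsilon> * (-1) ^ rank_in T t * poly p t}"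
        using sign less.prems(1) by (intro card_mono) auto
      finally show ?thesis
        using s(1) less.prems(1) deg by simp
    qed simp
  qed
qed

section \<open>Gale's points and the optimal cover\<close>

lemma rank_in_real_lessThan:
  "t \<le> N \<Longrightarrow> rank_in (real ` {..<N}) (real t) = t"
proof -
  assume "t \<le> N"
  then have "{u \<in> real ` {..<N}. u < real t} = real ` {..<t}" by auto
  then show ?thesis by (simp add: rank_in_def card_image)
qed

lemma antipodal_bar_open_cover_exists:
  fixes b :: "'a::euclidean_space"
  assumes dim: "DIM('a) = d + 1" and "n < m" and b: "b \<in> Basis"
  shows "\<exists>U. antipodal_bar_open_cover b n m (d + 2 * m - 1) U"
proof -
  define N where "N = d + 2 * m"
  obtain h where h: "bij_betw h (Basis - {b}) {1..d}"
    using finite_same_card_bij[of "Basis - {b}" "{1..d}"] dim b by (auto simp: card_Diff_singleton)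
  \<comment> \<open>Exponents of the moment curve. With exponent 0 at \<open>b\<close> only, just
    the \<open>b\<close>-coordinate survives at \<open>t = 0\<close>.\<close>
  define ex where "ex = h(b := 0)"
  have exb: "ex b = 0" by (simp add: ex_def)
  have ex_pos: "1 \<le> ex u" "ex u \<le> d" if "u \<in> Basis" "u \<noteq> b" for u
    using h that by (auto simp: ex_def bij_betw_def)
  have ex_inj: "inj_on ex Basis"
  proof (rule inj_onI)
    fix u v assume uv: "u \<in> Basis" "v \<in> Basis" "ex u = ex v"
    show "u = v"
    proof (cases "u = b \<or> v = b")
      case True
      then show ?thesis using uv exb ex_pos[of u] ex_pos[of v] by force
    next
      case False
      then show ?thesis using uv h by (auto simp: ex_def bij_betw_def inj_on_def)
    qed
  qed
  \<comment> \<open>The leading minus sign makes the curve start at \<open>- b\<close>.\<close>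
  define v :: "nat \<Rightarrow> 'a" where "v = (\<lambda>t. \<Sum>u\<in>Basis. (- ((-1) ^ t) * real t ^ ex u) *\<^sub>R u)"
  have v0: "v 0 = - b"
  proof -
    have "v 0 = (\<Sum>u\<in>Basis. if u = b then - b else 0)"
      unfolding v_def using exb ex_pos by (intro sum.cong) (force simp: power_0_left)+
    then show ?thesis using b by simp
  qed
  have gale: "m \<le> card {t. t < N \<and> 0 < x \<bullet> v t}" if "x \<in> sphere 0 1" for x
  proof -
    \<comment> \<open>Up to the sign \<open>- ((-1) ^ t)\<close>, \<open>x \<bullet> v t\<close> is
      the value of \<open>p\<close> at \<open>t\<close>.\<close>
    define p where "p = (\<Sum>u\<in>Basis. Polynomial.monom (x \<bullet> u) (ex u))"
    have coeff: "Polynomial.coeff p (ex u) = x \<bullet> u" if "u \<in> Basis" for u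
    proof -
      have "Polynomial.coeff p (ex u) = (\<Sum>w\<in>Basis. if w = u then x \<bullet> u else 0)"
        unfolding p_def Polynomial.coeff_sum Polynomial.coeff_monom
        using that ex_inj by (intro sum.cong) (auto simp: inj_on_def)
      then show ?thesis using that by simp
    qed
    have "x \<noteq> 0" using that by auto
    then obtain u where "u \<in> Basis" "x \<bullet> u \<noteq> 0"
      by (metis euclidean_all_zero_iff)
    then have "p \<noteq> 0" using coeff by force
    have "degree (Polynomial.monom (x \<bullet> u) (ex u)) \<le> d" if "u \<in> Basis" for u
      using degree_monom_le[of "x \<bullet> u" "ex u"] ex_pos[of u] exb that by (cases "u = b") auto
    then have deg: "degree p \<le> d"
      unfolding p_def by (intro degree_sum_le) auto
    have sgn: "- 1 * (-1) ^ t * poly p (real t) = x \<bullet> v t" for t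
      unfolding p_def v_def poly_sum poly_monom inner_sum_right
      by (simp add: sum_distrib_left sum_negf mult_ac)
    have "{s \<in> real ` {..<N}. 0 < - 1 * (-1) ^ rank_in (real ` {..<N}) s * poly p s} =
        real ` {t. t < N \<and> 0 < x \<bullet> v t}"
      by (auto simp: rank_in_real_lessThan simp flip: sgn)
    then have "N \<le> 2 * card {t. t < N \<and> 0 < x \<bullet> v t} + degree p + 1"
      using card_alternating_poly_pos[of "real ` {..<N}" p "- 1"] \<open>p \<noteq> 0\<close>
      by (simp add: card_image)
    \<comment> \<open>Twice the count is at least \<open>2 * m - 1\<close>, so by parity the count
      is at least \<open>m\<close>.\<close>
    then show ?thesis using deg by (simp add: N_def)
  qed
  \<comment> \<open>The shift by \<open>Suc\<close> discards the hemisphere centred at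
    \<open>v 0\<close>.\<close>
  define U where "U = (\<lambda>i. {x \<in> sphere 0 1. 0 < x \<bullet> v (Suc i)})"
  have U: "{t. t < N \<and> 0 < x \<bullet> v t} =
      (if 0 < x \<bullet> v 0 then {0} else {}) \<union> Suc ` {i. i < N - 1 \<and> x \<in> U i}"
    if "x \<in> sphere 0 1" for x
  proof -
    have "0 < N" using \<open>n < m\<close> by (simp add: N_def)
    have "t \<in> Suc ` {i. i < N - 1 \<and> x \<in> U i} \<longleftrightarrow> 0 < t \<and> t < N \<and> 0 < x \<bullet> v t" for t
      using that \<open>0 < N\<close> by (cases t) (auto simp: U_def)
    then show ?thesis using \<open>0 < N\<close> by (auto; metis gr0I)
  qed
  have cardU: "card {t. t < N \<and> 0 < x \<bullet> v t} =
      (if 0 < x \<bullet> v 0 then 1 else 0) + card {i. i < N - 1 \<and> x \<in> U i}"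
    if "x \<in> sphere 0 1" for x
    unfolding U[OF that] by (auto simp: card_image)
  have "antipodal_bar_open_cover b n m (N - 1) U"
    unfolding antipodal_bar_open_cover_def
  proof (intro conjI allI impI ballI)
    fix i
    have "open {x. 0 < x \<bullet> v (Suc i)}"
      by (intro open_Collect_less continuous_intros)
    moreover have "U i = sphere 0 1 \<inter> {x. 0 < x \<bullet> v (Suc i)}" by (auto simp: U_def)
    ultimately show "openin (top_of_set (sphere 0 1)) (U i)"
      by (simp add: openin_open_Int)
    show "- x \<notin> U i" if "x \<in> U i" for x
      using that by (auto simp: U_def)
  next
    fix x :: 'a assume x: "x \<in> sphere 0 1"
    \<comment> \<open>Discarding \<open>v 0\<close> costs at most one membership, and
      \<open>n \<le> m - 1\<close>; where \<open>0 \<le> x \<bullet> b\<close> it costs none,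
      because \<open>x \<bullet> v 0 \<le> 0\<close>.\<close>
    show "n \<le> card {i. i < N - 1 \<and> x \<in> U i}"
      using gale[OF x] cardU[OF x] \<open>n < m\<close> by (auto split: if_splits)
    show "m \<le> card {i. i < N - 1 \<and> x \<in> U i}" if "0 \<le> x \<bullet> b"
      using gale[OF x] cardU[OF x] that v0 by (auto split: if_splits)
  qed
  then show ?thesis by (auto simp: N_def)
qed

theorem theorem3:
  fixes b :: "'a::euclidean_space" and d n m :: nat
  assumes "DIM('a) = d + 1" and "1 \<le> d" and "1 \<le> n" and "n < m" and "b \<in> Basis"
  shows "(\<exists>U. antipodal_bar_open_cover b n m (d + 2 * m - 1) U) \<and>
         (\<forall>k U. antipodal_bar_open_cover b n m k U \<longrightarrow> d + 2 * m - 1 \<le> k)"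
  using antipodal_bar_open_cover_exists[OF assms(1,4,5)]
    antipodal_bar_open_cover_bound[OF assms(1,2) _ assms(5)] assms(3,4) by auto

end
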